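(* Let $C_{k,n}$ be the cone of copositive tensors of order $k$ and dimension $n$ and let $SC_{k,n}$ be the cone of strictly copositive tensors of order $k$ and dimension $n$. Then $SC_{k,n}$ is exactly the interior of $C_{k,n}$ (in the space $S_{k,n}$ of real symmetric tensors of order $k$ and dimension $n$).
   Context: A real $k$th order $n$-dimensional tensor is an array $\mathcal{A}=(a_{i_1\cdots i_k})$ of real numbers, $i_1,\dots,i_k\in\{1,\dots,n\}$; it is symmetric if its entries are invariant under every permutation of the indices. $S_{k,n}$ is the finite-dimensional real vector space of all symmetric such tensors, with its usual topology (e.g. from the Frobenius norm). For a vector $x$, $\mathcal{A}x^k = \sum_{i_1,\dots,i_k=1}^n a_{i_1\cdots i_k}x_{i_1}\cdots x_{i_k}$. $\mathbb{R}^n_+$ is the set of vectors in $\mathbb{R}^n$ with all components nonnegative. $\mathcal{A}\in S_{k,n}$ is copositive if $\mathcal{A}x^k\ge 0$ for all $x\in\mathbb{R}^n_+$, and strictly copositive if $\mathcal{A}x^k>0$ for all $x\in\mathbb{R}^n_+$, $x\ne 0$. *)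

theory Defs
  imports "HOL-Analysis.Analysis"
begin

text \<open>
  A real tensor of order \<open>k = CARD('k)\<close> and dimension \<open>n = CARD('n)\<close>: the index tuple
  \<open>(i_1, ..., i_k)\<close> is an element \<open>i :: 'n ^ 'k\<close>, with \<open>i $ j\<close> the index in position \<open>j\<close>, and
  \<open>A $ i\<close> is the corresponding entry. The norm of this Euclidean space is the Frobenius norm.
\<close>

type_synonym ('k, 'n) tensor = "(real, ('n, 'k) vec) vec"

definition symmetric_tensors :: "('k::finite, 'n::finite) tensor set" where
  "symmetric_tensors =
     {A. \<forall>p i. p permutes (UNIV :: 'k set) \<longrightarrow> A $ (\<chi> j. i $ p j) = A $ i}"

definition tensor_form :: "('k::finite, 'n::finite) tensor \<Rightarrow> real ^ 'n \<Rightarrow> real" where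
  "tensor_form A x = (\<Sum>i\<in>UNIV. A $ i * (\<Prod>j\<in>UNIV. x $ (i $ j)))"

definition nonneg_orthant :: "(real ^ 'n::finite) set" where
  "nonneg_orthant = {x. \<forall>i. 0 \<le> x $ i}"

definition copositive :: "('k::finite, 'n::finite) tensor \<Rightarrow> bool" where
  "copositive A \<longleftrightarrow> (\<forall>x\<in>nonneg_orthant. tensor_form A x \<ge> 0)"

definition strictly_copositive :: "('k::finite, 'n::finite) tensor \<Rightarrow> bool" where
  "strictly_copositive A \<longleftrightarrow> (\<forall>x\<in>nonneg_orthant. x \<noteq> 0 \<longrightarrow> tensor_form A x > 0)"

definition copositive_tensors :: "('k::finite, 'n::finite) tensor set" where
  "copositive_tensors = {A \<in> symmetric_tensors. copositive A}"

definition strictly_copositive_tensors :: "('k::finite, 'n::finite) tensor set" where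
  "strictly_copositive_tensors = {A \<in> symmetric_tensors. strictly_copositive A}"

end

theory Submission imports Defs begin

text \<open>
  For fixed \<open>x\<close>, \<open>A x\<^sup>k\<close> is the inner product of \<open>A\<close> with the rank-one tensor \<open>x\<^sup>\<otimes>\<^sup>k\<close>. By homogeneity,
  strict copositivity says that \<open>A\<close> has positive inner product with every element of the compact
  set of all \<open>x\<^sup>\<otimes>\<^sup>k\<close> with \<open>x \<ge> 0\<close> and \<open>norm x = 1\<close>, which is an open condition on \<open>A\<close>. Conversely, if \<open>A\<close> is
  interior, then \<open>A - \<epsilon> J\<close> is copositive for some \<open>\<epsilon> > 0\<close>, where \<open>J\<close> is the symmetric all-ones
  tensor; as \<open>J\<close> is strictly copositive, so is \<open>A\<close>.
\<close>

text \<open>The complement is the projection of the closed set of pairs \<open>(s, a)\<close> with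
  \<open>a \<bullet> s \<le> 0\<close> along the compact factor \<open>S\<close>, and projecting
  along a compact factor preserves closedness.\<close>

lemma open_inner_pos_on_compact:
  fixes S :: "'a::euclidean_space set"
  assumes "compact S"
  shows "open {a. \<forall>s\<in>S. 0 < a \<bullet> s}"
proof -
  have "closed {z::'a \<times> 'a. snd z \<bullet> fst z \<le> 0}"
    by (intro closed_Collect_le continuous_intros)
  from closed_compact_projection[OF assms this]
  have "closed {a. \<exists>s. s \<in> S \<and> a \<bullet> s \<le> 0}" by simp
  moreover have "{a. \<forall>s\<in>S. 0 < a \<bullet> s} = - {a. \<exists>s. s \<in> S \<and> a \<bullet> s \<le> 0}"
    by (auto simp: not_le)
  ultimately show ?thesis by (simp add: open_closed)
qed

definition rank_one_tensor :: "real ^ 'n \<Rightarrow> ('k::finite, 'n::finite) tensor" where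
  "rank_one_tensor x = (\<chi> i. \<Prod>j\<in>UNIV. x $ (i $ j))"

lemma tensor_form_eq_inner: "tensor_form A x = A \<bullet> rank_one_tensor x"
  by (simp add: tensor_form_def rank_one_tensor_def inner_vec_def)

lemma tensor_form_scaleR:
  fixes A :: "('k::finite, 'n::finite) tensor"
  shows "tensor_form A (c *\<^sub>R x) = c ^ CARD('k) * tensor_form A x"
  by (simp add: tensor_form_def prod.distrib sum_distrib_left mult.left_commute)

lemma continuous_on_rank_one_tensor: "continuous_on S rank_one_tensor"
  unfolding rank_one_tensor_def by (intro continuous_intros)

lemma closed_nonneg_orthant: "closed (nonneg_orthant :: (real ^ 'n::finite) set)"
  unfolding nonneg_orthant_def by (intro closed_Collect_all closed_Collect_le continuous_intros)

lemma strictly_copositive_iff_sphere: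
  fixes A :: "('k::finite, 'n::finite) tensor"
  shows "strictly_copositive A \<longleftrightarrow> (\<forall>x\<in>nonneg_orthant \<inter> sphere 0 1. 0 < tensor_form A x)"
proof
  assume "strictly_copositive A"
  then show "\<forall>x\<in>nonneg_orthant \<inter> sphere 0 1. 0 < tensor_form A x"
    by (auto simp: strictly_copositive_def)
next
  assume *: "\<forall>x\<in>nonneg_orthant \<inter> sphere 0 1. 0 < tensor_form A x"
  show "strictly_copositive A"
    unfolding strictly_copositive_def
  proof (intro ballI impI)
    fix x :: "real ^ 'n" assume x: "x \<in> nonneg_orthant" "x \<noteq> 0"
    have "inverse (norm x) *\<^sub>R x \<in> nonneg_orthant \<inter> sphere 0 1"
      using x by (auto simp: nonneg_orthant_def)
    with * have "0 < tensor_form A (inverse (norm x) *\<^sub>R x)" by blast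
    then show "0 < tensor_form A x"
      \<comment> \<open>The factor \<open>inverse (norm x) ^ CARD('k)\<close> is positive, so
        normalising \<open>x\<close> does not change the sign of the form.\<close>
      using x by (simp add: tensor_form_scaleR zero_less_mult_iff)
  qed
qed

lemma open_strictly_copositive:
  "open {A :: ('k::finite, 'n::finite) tensor. strictly_copositive A}"
proof -
  let ?S = "rank_one_tensor ` (nonneg_orthant \<inter> sphere 0 1) :: ('k, 'n) tensor set"
  have "compact ?S"
    by (intro compact_continuous_image continuous_on_rank_one_tensor closed_Int_compact
        closed_nonneg_orthant compact_sphere)
  then have "open {A. \<forall>s\<in>?S. 0 < A \<bullet> s}"
    by (rule open_inner_pos_on_compact)
  then show ?thesis
    by (simp add: strictly_copositive_iff_sphere tensor_form_eq_inner)
qed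

definition all_ones_tensor :: "('k::finite, 'n::finite) tensor" where
  "all_ones_tensor = (\<chi> i. 1)"

lemma strictly_copositive_all_ones:
  "strictly_copositive (all_ones_tensor :: ('k::finite, 'n::finite) tensor)"
  unfolding strictly_copositive_def
proof (intro ballI impI)
  fix x :: "real ^ 'n" assume x: "x \<in> nonneg_orthant" "x \<noteq> 0"
  then obtain m where "x $ m \<noteq> 0" by (auto simp: vec_eq_iff)
  with x have m: "0 < x $ m" by (simp add: nonneg_orthant_def less_le)
  have "0 < (\<Sum>i\<in>(UNIV :: ('n ^ 'k) set). \<Prod>j\<in>UNIV. x $ (i $ j))"
    \<comment> \<open>The constant index tuple \<open>(m, ..., m)\<close> contributes a power of
      \<open>x $ m\<close>, which is positive; all other summands are nonnegative.\<close>
    by (rule sum_pos2[where i = "\<chi> j. m"])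
      (use x m in \<open>auto simp: nonneg_orthant_def intro: prod_nonneg\<close>)
  then show "0 < tensor_form (all_ones_tensor :: ('k, 'n) tensor) x"
    by (simp add: tensor_form_def all_ones_tensor_def)
qed

lemma symmetric_tensors_diff_all_ones:
  "A \<in> symmetric_tensors \<Longrightarrow> A - c *\<^sub>R all_ones_tensor \<in> symmetric_tensors"
  by (simp add: symmetric_tensors_def all_ones_tensor_def)

lemma strictly_copositive_if_interior:
  fixes A :: "('k::finite, 'n::finite) tensor"
  assumes A: "A \<in> top_of_set symmetric_tensors interior_of copositive_tensors"
  shows "strictly_copositive A"
proof -
  let ?J = "all_ones_tensor :: ('k, 'n) tensor"
  from A obtain U where U: "open U" "A \<in> symmetric_tensors" "A \<in> U"
      "symmetric_tensors \<inter> U \<subseteq> copositive_tensors"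
    by (auto simp: interior_of_def openin_open)
  \<comment> \<open>The segment from \<open>A\<close> in direction \<open>-J\<close> stays among the
    symmetric tensors, so it only has to stay in \<open>U\<close> to be copositive. The one-sided
    limit at 0 yields such a point with \<open>e > 0\<close>.\<close>
  have "((\<lambda>e. A - e *\<^sub>R ?J) \<longlongrightarrow> A - 0 *\<^sub>R ?J) (at_right 0)"
    by (intro tendsto_intros)
  then have "\<forall>\<^sub>F e in at_right 0. A - e *\<^sub>R ?J \<in> U"
    using U by (intro topological_tendstoD) auto
  then have "\<forall>\<^sub>F e in at_right 0. 0 < e \<and> A - e *\<^sub>R ?J \<in> U"
    using eventually_at_right_less by (rule eventually_conj[rotated])
  then obtain e :: real where e: "0 < e" "A - e *\<^sub>R ?J \<in> U"
    by (metis (no_types, lifting) eventually_happens' trivial_limit_at_right_real)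
  then have cop: "copositive (A - e *\<^sub>R ?J)"
    using U symmetric_tensors_diff_all_ones by (auto simp: copositive_tensors_def)
  show ?thesis
    unfolding strictly_copositive_def
  proof (intro ballI impI)
    fix x :: "real ^ 'n" assume x: "x \<in> nonneg_orthant" "x \<noteq> 0"
    have "0 < e * tensor_form ?J x"
      using e x strictly_copositive_all_ones[where 'k = 'k and 'n = 'n]
      unfolding strictly_copositive_def by simp
    moreover have "0 \<le> tensor_form A x - e * tensor_form ?J x"
      using cop x unfolding copositive_def
      by (simp add: tensor_form_eq_inner inner_diff_left)
    ultimately show "0 < tensor_form A x" by linarith
  qed
qed

text \<open>Strict copositivity says nothing at \<open>x = 0\<close>. There the form vanishes
  because the order \<open>CARD('k)\<close> is at least 1.\<close>

lemma copositive_if_strictly_copositive: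
  fixes A :: "('k::finite, 'n::finite) tensor"
  assumes "strictly_copositive A"
  shows "copositive A"
  unfolding copositive_def
proof
  fix x :: "real ^ 'n" assume "x \<in> nonneg_orthant"
  then show "0 \<le> tensor_form A x"
    using assms by (cases "x = 0")
      (auto simp: strictly_copositive_def tensor_form_def zero_power less_imp_le)
qed

theorem proposition13:
  shows "(strictly_copositive_tensors :: ('k::finite, 'n::finite) tensor set) =
         top_of_set symmetric_tensors interior_of copositive_tensors"
proof
  show "(strictly_copositive_tensors :: ('k, 'n) tensor set)
      \<subseteq> top_of_set symmetric_tensors interior_of copositive_tensors"
  proof (rule interior_of_maximal)
    show "(strictly_copositive_tensors :: ('k, 'n) tensor set) \<subseteq> copositive_tensors"
      by (auto simp: strictly_copositive_tensors_def copositive_tensors_def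
          copositive_if_strictly_copositive)
    \<comment> \<open>Strict copositivity is open in the space of all tensors; intersecting with
      \<open>symmetric_tensors\<close> gives relative openness.\<close>
    have "(strictly_copositive_tensors :: ('k, 'n) tensor set)
        = symmetric_tensors \<inter> {A. strictly_copositive A}"
      by (auto simp: strictly_copositive_tensors_def)
    then show "openin (top_of_set symmetric_tensors)
        (strictly_copositive_tensors :: ('k, 'n) tensor set)"
      using openin_open_Int[OF open_strictly_copositive] by metis
  qed
  show "top_of_set symmetric_tensors interior_of copositive_tensors
      \<subseteq> (strictly_copositive_tensors :: ('k, 'n) tensor set)"
    \<comment> \<open>\<open>interior_of_subset\<close> supplies the symmetry of an interior
      tensor.\<close>
    using interior_of_subset strictly_copositive_if_interior
    by (fastforce simp: strictly_copositive_tensors_def copositive_tensors_def)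
qed

end
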